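(* Suppose that for every $T\subseteq[n]$ with $|T|=\lfloor s/2\rfloor$ the column submatrix $A_{:T}$ has full row rank, and let $\gamma>0$ be defined by $\gamma^2=\min_{|T|=\lfloor s/2\rfloor}\lambda_{\min}(A_{:T}A_{:T}^\top)$. Let $c_1,c_2>0$ be the constants used in iPAL, let $\mu>0$, put $c_3:=(2c_1+\mu+2)/\gamma$, $c_4:=(2c_1+\mu)/\gamma$, let $\rho\ge\max\{2/\gamma^2,\ 8(c_3^2+c_4^2)/\mu\}$ and $\eta=4c_4^2/\rho$. Let $\{(u^k,z^k)\}_{k\in\mathbb{N}}$ be a sequence generated by iPAL, let $(u^*,z^* )$, $u^*=[w^*;\xi^*]$, be its limit, let $\mathcal M_{k+1}:=\mathcal M_{\rho,\eta}(u^{k+1},z^{k+1},w^k)$ for $k=0,1,\dots$, and let $\mathcal M_*:=\lim_{k\to\infty}\mathcal M_k$. Then there is a constant $q\in(0,1)$ such that the following hold. (i) There exist a positive constant $c_m$ and a sufficiently large index $k^*$ such that $\mathcal M_k-\mathcal M_*\le c_m q^k$ for all $k\ge k^*$. (ii) There exist a sufficiently large index $k^*$ and positive constants $c_w,c_\xi,c_z$ such that for all $k\ge k^*$, $$\|w^k-w^*\|\le c_w\sqrt q^{\,k},\qquad \|\xi^k-\xi^*\|\le c_\xi\sqrt q^{\,k},\qquad \|z^k-z^*\|\le c_z\sqrt q^{\,k}.$$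
   Context: Setting: $m,n,s$ are positive integers with $s\le n$, $\lambda>0$, and $A\in\mathbb{R}^{m\times n}$ is the data matrix whose $i$-th row is $-y_i[x_i^\top,1]$, with $x_i\in\mathbb{R}^{n-1}$, $y_i\in\{1,-1\}$. $[n]=\{1,\dots,n\}$; for an index set $T$, $\overline T$ is its complement, $w_T$ the subvector and $A_{:T}$ the submatrix of columns indexed by $T$. $\mathbf 1$ is the all-ones vector; $\|w\|_0$ is the number of nonzero entries of $w$; $\mathbb{S}:=\{w\in\mathbb{R}^n:\|w\|_0\le s\}$ with indicator function $\delta_{\mathbb{S}}$ ($0$ on $\mathbb{S}$, $+\infty$ off it). $J(\xi):=\sum_{i=1}^m h(\xi_i)$ for $\xi\in\mathbb{R}^m$, with $h(t)=1$ if $t>0$, $h(t)=0$ if $t\le0$. Write $u=[w;\xi]\in\mathbb{R}^{n+m}$, $u^k=[w^k;\xi^k]$. $\Phi_{\beta\lambda J(\cdot)}(\xi):=\min_q\{\lambda J(q)+\frac1{2\beta}\|q-\xi\|^2\}$. $\mathcal T_s(w)$ is the collection of all sets of $s$ indices giving the $s$ largest entries of $|w|$ in absolute value. For $\rho,\mu>0$ let $$\mathcal M_{\rho,\mu}(u,z,v):=g(u,z,v)+\delta_{\mathbb{S}}(w)+\lambda J(\xi),$$ $$g(u,z,v):=\tfrac12\|w\|^2+\langle z,Aw+\mathbf 1-\xi\rangle+\tfrac\rho2\|Aw+\mathbf 1-\xi\|^2+\tfrac\mu2\|w-v\|^2,$$ and $g_k(u):=g(u,z^k,w^k)$. ($\mathcal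 M_{\rho,\eta}$ is the same function with $\mu$ replaced by $\eta$.) Residuals (with fixed constants $\alpha,\beta>0$): for $u=[w;\xi]$ pick $T\in\mathcal T_s(w-\alpha\nabla_w g_k(u))$ and let $\Gamma=\{i\in[m]:[\xi-\beta\nabla_\xi g_k(u)]_i\in(-\infty,0]\cup[\sqrt{2\beta\lambda},\infty)\}$; then $\mathcal R_1(u)=\|[(\nabla_w g_k(u))_T;\,w_{\overline T}]\|$, $\mathcal R_2(u)=\|[(\nabla_\xi g_k(u))_\Gamma;\,\xi_{\overline\Gamma}]\|$, $\mathcal R_3(u)=\frac\beta2\|\nabla_\xi g_k(u)\|^2+\lambda J(\xi)-\Phi_{\beta\lambda J(\cdot)}(\xi-\beta\nabla_\xi g_k(u))$. Algorithm iPAL: given constants $c_1,c_2>0$, an initial point $(u^0,z^0)$ and a positive sequence $\vartheta_k\to0$, for $k=0,1,\dots$: (1) find $u^{k+1}$ satisfying $\mathcal M_{\rho,\mu}(u^{k+1},z^k,w^k)\le\mathcal M_{\rho,\mu}(u^k,z^k,w^k)$, $\|w^{k+1}\|_0\le s$, $\mathcal R_1(u^{k+1})\le c_1\|w^{k+1}-w^k\|$, $\mathcal R_2(u^{k+1})\le c_2\|w^{k+1}-w^k\|^2$, $\mathcal R_3(u^{k+1})\le\vartheta_k$; (2) set $z^{k+1}=z^k+\rho(Aw^{k+1}+\mathbf 1-\xi^{k+1})$. Under the hypotheses of the claim, the whole sequence $(u^k,z^k)$ converges and $\{\mathcal M_k\}$ is nonincreasing and convergent, so $(u^*,z^* )$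 and $\mathcal M_*$ are well defined (a previously established result of the paper). *)

theory Defs
  imports "HOL-Analysis.Analysis"
begin

(* Gradient of a function on a Euclidean space (unique whenever it exists). *)
definition grad :: "('a::real_inner \<Rightarrow> real) \<Rightarrow> 'a \<Rightarrow> 'a" where
  "grad f x = (THE d. GDERIV f x :> d)"

(* The columns of the data matrix are indexed by 'n; the index b is the bias column, and the
   n - 1 features of the i-th sample are the numbers x i j for j \<noteq> b (x i b is ignored).
   The i-th row is therefore - y_i [x_i, 1]. *)
definition data_matrix ::
  "'n \<Rightarrow> ('m \<Rightarrow> 'n \<Rightarrow> real) \<Rightarrow> ('m \<Rightarrow> real) \<Rightarrow> real^'n^'m" where
  "data_matrix b x y = (\<chi> i j. - y i * (if j = b then 1 else x i j))"

(* Column submatrix, padded with zero columns outside T so that the type does not depend on T: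
   its rank and its product with its own transpose are those of the genuine submatrix. *)
definition cols :: "real^'n^'m \<Rightarrow> 'n set \<Rightarrow> real^'n^'m" where
  "cols A T = (\<chi> i j. if j \<in> T then A $ i $ j else 0)"

definition full_row_rank :: "real^'n^'m \<Rightarrow> bool" where
  "full_row_rank A \<longleftrightarrow> rank A = CARD('m)"

definition eigenvalues :: "real^'m^'m \<Rightarrow> real set" where
  "eigenvalues B = {l. \<exists>v. v \<noteq> 0 \<and> B *v v = l *\<^sub>R v}"

(* Used for symmetric matrices only, all of whose eigenvalues are real. *)
definition lambda_min :: "real^'m^'m \<Rightarrow> real" where
  "lambda_min B = Min (eigenvalues B)"

definition l0norm :: "real^'n \<Rightarrow> nat" where
  "l0norm w = card {i. w $ i \<noteq> 0}"

definition sparse_set :: "nat \<Rightarrow> (real^'n) set" where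
  "sparse_set s = {w. l0norm w \<le> s}"

definition ind :: "'a set \<Rightarrow> 'a \<Rightarrow> ereal" where
  "ind S w = (if w \<in> S then 0 else \<infinity>)"

definition step_fn :: "real \<Rightarrow> real" where
  "step_fn t = (if t > 0 then 1 else 0)"

definition J :: "real^'m \<Rightarrow> real" where
  "J \<xi> = (\<Sum>i\<in>UNIV. step_fn (\<xi> $ i))"

(* Moreau envelope with parameter \<beta>; for f = lam * J the infimum is attained. *)
definition moreau :: "real \<Rightarrow> ('a::real_normed_vector \<Rightarrow> real) \<Rightarrow> 'a \<Rightarrow> real" where
  "moreau \<beta> f \<xi> = (INF q. f q + 1 / (2 * \<beta>) * (norm (q - \<xi>))\<^sup>2)"

definition top_sets :: "nat \<Rightarrow> real^'n \<Rightarrow> 'n set set" where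
  "top_sets s w = {T. card T = s \<and> (\<forall>i\<in>T. \<forall>j\<in>-T. \<bar>w $ j\<bar> \<le> \<bar>w $ i\<bar>)}"

fun g_fun :: "real^'n^'m \<Rightarrow> real \<Rightarrow> real \<Rightarrow> (real^'n) \<times> (real^'m) \<Rightarrow> real^'m \<Rightarrow> real^'n \<Rightarrow> real" where
  "g_fun A \<rho> \<mu> (w, \<xi>) z v =
     1 / 2 * (norm w)\<^sup>2 + z \<bullet> (A *v w + vec 1 - \<xi>)
     + \<rho> / 2 * (norm (A *v w + vec 1 - \<xi>))\<^sup>2 + \<mu> / 2 * (norm (w - v))\<^sup>2"

definition M_fun ::
  "real^'n^'m \<Rightarrow> nat \<Rightarrow> real \<Rightarrow> real \<Rightarrow> real
     \<Rightarrow> (real^'n) \<times> (real^'m) \<Rightarrow> real^'m \<Rightarrow> real^'n \<Rightarrow> ereal" where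
  "M_fun A s lam \<rho> \<mu> u z v =
     ereal (g_fun A \<rho> \<mu> u z v) + ind (sparse_set s) (fst u) + ereal (lam * J (snd u))"

definition grad_w ::
  "((real^'n) \<times> (real^'m) \<Rightarrow> real) \<Rightarrow> (real^'n) \<times> (real^'m) \<Rightarrow> real^'n" where
  "grad_w G u = grad (\<lambda>w. G (w, snd u)) (fst u)"

definition grad_xi ::
  "((real^'n) \<times> (real^'m) \<Rightarrow> real) \<Rightarrow> (real^'n) \<times> (real^'m) \<Rightarrow> real^'m" where
  "grad_xi G u = grad (\<lambda>\<xi>. G (fst u, \<xi>)) (snd u)"

(* [a_T; b_(-T)], with every entry kept at its own index instead of being stacked;
   this does not affect the Euclidean norm. *)
definition splice_vec :: "'k set \<Rightarrow> real^'k \<Rightarrow> real^'k \<Rightarrow> real^'k" where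
  "splice_vec T a b = (\<chi> i. if i \<in> T then a $ i else b $ i)"

(* In the residuals G plays the role of g_k, the map u \<mapsto> g_fun A \<rho> \<mu> u (z k) (w k). *)

definition R1 ::
  "((real^'n) \<times> (real^'m) \<Rightarrow> real) \<Rightarrow> 'n set \<Rightarrow> (real^'n) \<times> (real^'m) \<Rightarrow> real" where
  "R1 G T u = norm (splice_vec T (grad_w G u) (fst u))"

definition Gamma_set ::
  "real \<Rightarrow> real \<Rightarrow> ((real^'n) \<times> (real^'m) \<Rightarrow> real) \<Rightarrow> (real^'n) \<times> (real^'m) \<Rightarrow> 'm set" where
  "Gamma_set \<beta> lam G u =
     {i. (snd u - \<beta> *\<^sub>R grad_xi G u) $ i \<in> {..0} \<union> {sqrt (2 * \<beta> * lam)..}}"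

definition R2 ::
  "real \<Rightarrow> real \<Rightarrow> ((real^'n) \<times> (real^'m) \<Rightarrow> real) \<Rightarrow> (real^'n) \<times> (real^'m) \<Rightarrow> real" where
  "R2 \<beta> lam G u = norm (splice_vec (Gamma_set \<beta> lam G u) (grad_xi G u) (snd u))"

definition R3 ::
  "real \<Rightarrow> real \<Rightarrow> ((real^'n) \<times> (real^'m) \<Rightarrow> real) \<Rightarrow> (real^'n) \<times> (real^'m) \<Rightarrow> real" where
  "R3 \<beta> lam G u =
     \<beta> / 2 * (norm (grad_xi G u))\<^sup>2 + lam * J (snd u)
     - moreau \<beta> (\<lambda>q. lam * J q) (snd u - \<beta> *\<^sub>R grad_xi G u)"

(* One step of the algorithm from (u, z) to (u', z') with tolerance \<theta>;
   the set T of the first residual may be any selection from top_sets. *)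
definition iPAL_step ::
  "real^'n^'m \<Rightarrow> nat \<Rightarrow> real \<Rightarrow> real \<Rightarrow> real \<Rightarrow> real \<Rightarrow> real \<Rightarrow> real \<Rightarrow> real \<Rightarrow> real
     \<Rightarrow> (real^'n) \<times> (real^'m) \<Rightarrow> real^'m \<Rightarrow> (real^'n) \<times> (real^'m) \<Rightarrow> real^'m \<Rightarrow> bool" where
  "iPAL_step A s lam \<rho> \<mu> \<alpha> \<beta> c1 c2 \<theta> u z u' z' \<longleftrightarrow>
     (let G = (\<lambda>p. g_fun A \<rho> \<mu> p z (fst u)) in
        M_fun A s lam \<rho> \<mu> u' z (fst u) \<le> M_fun A s lam \<rho> \<mu> u z (fst u) \<and>
        l0norm (fst u') \<le> s \<and>
        (\<exists>T \<in> top_sets s (fst u' - \<alpha> *\<^sub>R grad_w G u'). R1 G T u' \<le> c1 * norm (fst u' - fst u)) \<and>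
        R2 \<beta> lam G u' \<le> c2 * (norm (fst u' - fst u))\<^sup>2 \<and>
        R3 \<beta> lam G u' \<le> \<theta> \<and>
        z' = z + \<rho> *\<^sub>R (A *v fst u' + vec 1 - snd u'))"

definition iPAL_sequence ::
  "real^'n^'m \<Rightarrow> nat \<Rightarrow> real \<Rightarrow> real \<Rightarrow> real \<Rightarrow> real \<Rightarrow> real \<Rightarrow> real \<Rightarrow> real \<Rightarrow> (nat \<Rightarrow> real)
     \<Rightarrow> (nat \<Rightarrow> (real^'n) \<times> (real^'m)) \<Rightarrow> (nat \<Rightarrow> real^'m) \<Rightarrow> bool" where
  "iPAL_sequence A s lam \<rho> \<mu> \<alpha> \<beta> c1 c2 \<theta> u z \<longleftrightarrow>
     (\<forall>k. \<theta> k > 0) \<and> \<theta> \<longlonglongrightarrow> 0 \<and>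
     (\<forall>k. iPAL_step A s lam \<rho> \<mu> \<alpha> \<beta> c1 c2 (\<theta> k) (u k) (z k) (u (Suc k)) (z (Suc k)))"

end

theory Submission
  imports Defs
begin

text \<open>
  Let \<open>d\<^sub>k = norm (w\<^sup>k\<^sup>+\<^sup>1 - w\<^sup>k)\<close> and \<open>r\<^sup>k = A w\<^sup>k + 1 - \<xi>\<^sup>k\<close>. The multiplier update is
  chosen so that at \<open>u\<^sup>k\<^sup>+\<^sup>1\<close> the two partial gradients of the inner objective are
  \<open>w\<^sup>k\<^sup>+\<^sup>1 + A\<^sup>T z\<^sup>k\<^sup>+\<^sup>1 + \<mu> (w\<^sup>k\<^sup>+\<^sup>1 - w\<^sup>k)\<close> and \<open>- z\<^sup>k\<^sup>+\<^sup>1\<close>. The residual conditions thus say, up to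
  errors of order \<open>d\<^sub>k\<close>, that \<open>w\<^sup>k\<^sup>+\<^sup>1 + A\<^sup>T z\<^sup>k\<^sup>+\<^sup>1\<close> vanishes on an index set \<open>T\<close> of size \<open>s\<close> and
  that \<open>w\<^sup>k\<^sup>+\<^sup>1\<close> vanishes off \<open>T\<close>; and, up to errors of order \<open>d\<^sub>k\<^sup>2\<close>, that each coordinate has
  \<open>z\<^sup>k\<^sup>+\<^sup>1 = 0\<close> or \<open>\<xi>\<^sup>k\<^sup>+\<^sup>1 = 0\<close>.

  Two facts turn this into a linear rate.

  Descent. The sets \<open>T\<close> of two consecutive iterates either share at least half of \<open>s\<close> indices, or
  differ in at least that many. In both cases the coercivity of \<open>A\<^sub>T\<^sup>T\<close> for sets of that size
  bounds the dual step by \<open>c3 d\<^sub>k + c4 d\<^sub>k\<^sub>-\<^sub>1\<close> (lemma \<open>dual_step_bound\<close>). The increase of the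
  Lagrangian caused by the multiplier update is the squared dual step divided by \<open>\<rho>\<close>, so for
  large \<open>\<rho>\<close> it is paid for by the proximal decrease, once the lagged term with weight \<open>\<eta>\<close> is
  included: the merit value drops by at least \<open>\<mu>/4 d\<^sub>k\<^sup>2\<close> (lemma \<open>E_descent\<close>).

  Error bound. Near the limit the value of \<open>J\<close> no longer changes, and then the gap between the
  Lagrangian and its limit is
  \<open>\<langle>w\<^sup>k + A\<^sup>T z\<^sup>k, w\<^sup>k - w\<^sup>*\<rangle> - 1/2 norm(w\<^sup>k - w\<^sup>*)\<^sup>2 - \<langle>z\<^sup>k, \<xi>\<^sup>k - \<xi>\<^sup>*\<rangle> + \<rho>/2 norm(r\<^sup>k)\<^sup>2\<close>
  (lemma \<open>Lagr_gap_identity\<close>). Each product is of second order in the steps. On \<open>T\<close> the gradient is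
  of first order and the negative square absorbs the other factor. Off \<open>T\<close> the vector \<open>w\<^sup>*\<close>
  vanishes, and either \<open>w\<^sup>k\<close> vanishes there as well, or some entry of \<open>w\<^sup>k\<close> inside \<open>T\<close> is zero,
  in which case the choice of \<open>T\<close> as a top set makes the gradient small off \<open>T\<close> too (lemma
  \<open>inner_off_top_set_quadratic\<close>). The pairing of \<open>z\<^sup>k\<close> with \<open>\<xi>\<^sup>k - \<xi>\<^sup>*\<close> is of second order by the
  complementarity above.

  Hence the merit gap is at most a constant times \<open>d\<^sub>k\<^sup>2 + d\<^sub>k\<^sub>-\<^sub>1\<^sup>2\<close>, which by descent is at most a
  constant times the decrease of the merit over two iterations. So the gap contracts by a fixed
  factor every two iterations. Descent then bounds the steps by the square root of the gap, and
  summing the steps gives the rates of the iterates.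
\<close>

section \<open>Rayleigh quotients of symmetric matrices\<close>

text \<open>Eigenvectors for distinct eigenvalues are orthogonal, hence independent. Finiteness is what makes
  the minimum in \<open>lambda_min\<close> meaningful.\<close>
lemma finite_eigenvalues_symmetric:
  fixes B :: "real^'m^'m"
  assumes sym: "transpose B = B"
  shows "finite (eigenvalues B)"
proof -
  define ev where "ev l = (SOME v. v \<noteq> 0 \<and> B *v v = l *\<^sub>R v)" for l
  have ev: "ev l \<noteq> 0" "B *v ev l = l *\<^sub>R ev l" if "l \<in> eigenvalues B" for l
    using someI_ex[of "\<lambda>v. v \<noteq> 0 \<and> B *v v = l *\<^sub>R v"] that
    unfolding ev_def eigenvalues_def by auto
  have orth: "ev k \<bullet> ev l = 0" if kl: "k \<in> eigenvalues B" "l \<in> eigenvalues B" "k \<noteq> l" for k l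
  proof -
    have "(B *v ev k) \<bullet> ev l = ev k \<bullet> (B *v ev l)"
      by (metis dot_lmul_matrix sym transpose_matrix_vector)
    then have "(k - l) * (ev k \<bullet> ev l) = 0"
      using ev(2) kl by (simp add: left_diff_distrib)
    then show ?thesis using kl by simp
  qed
  have inj: "inj_on ev (eigenvalues B)"
    by (rule inj_onI) (metis ev(1) inner_eq_zero_iff orth)
  have "pairwise orthogonal (ev ` eigenvalues B)"
    using orth by (auto simp: pairwise_def orthogonal_def)
  moreover have "0 \<notin> ev ` eigenvalues B" using ev(1) by auto
  ultimately have "finite (ev ` eigenvalues B)"
    using pairwise_orthogonal_independent independent_imp_finite by blast
  then show ?thesis using inj finite_imageD by blast
qed

text \<open>The Rayleigh quotient attains its minimum \<open>l\<close> on the compact unit sphere, at \<open>e\<close> say. The form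
  \<open>v \<bullet> B v - l (v \<bullet> v)\<close> is then nonnegative and vanishes at \<open>e\<close>; perturbing \<open>e\<close> in the
  direction \<open>D = B e - l e\<close> shows \<open>D = 0\<close>, so the minimum is itself an eigenvalue.\<close>
lemma lambda_min_le_Rayleigh:
  fixes B :: "real^'m^'m"
  assumes sym: "transpose B = B"
  shows "lambda_min B * (norm v)\<^sup>2 \<le> v \<bullet> (B *v v)"
proof -
  have cont: "continuous_on (sphere 0 1) (\<lambda>v. v \<bullet> (B *v v))"
    by (intro continuous_intros linear_continuous_on matrix_vector_mul_bounded_linear)
  have "sphere (0::real^'m) 1 \<noteq> {}" by simp
  then obtain e where e: "norm e = 1"
    and least: "\<And>v. norm v = 1 \<Longrightarrow> e \<bullet> (B *v e) \<le> v \<bullet> (B *v v)"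
    using continuous_attains_inf[OF compact_sphere _ cont] by (metis dist_0_norm mem_sphere)
  define l where "l = e \<bullet> (B *v e)"
  define D where "D = B *v e - l *\<^sub>R e"
  have form: "l * (norm v)\<^sup>2 \<le> v \<bullet> (B *v v)" for v
  proof (cases "v = 0")
    case False
    have "l \<le> (v /\<^sub>R norm v) \<bullet> (B *v (v /\<^sub>R norm v))"
      unfolding l_def by (rule least) (use False in simp)
    then show ?thesis
      using False by (simp add: matrix_vector_mult_scaleR power2_eq_square field_simps)
  qed simp
  have selfadj: "e \<bullet> (B *v D) = D \<bullet> (B *v e)"
    by (metis dot_lmul_matrix inner_commute sym transpose_matrix_vector)
  define Q where "Q = D \<bullet> (B *v D) - l * (D \<bullet> D)"
  have pert: "0 \<le> 2 * t * (D \<bullet> D) + t\<^sup>2 * Q" for t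
  proof -
    have "0 \<le> (e + t *\<^sub>R D) \<bullet> (B *v (e + t *\<^sub>R D)) - l * ((e + t *\<^sub>R D) \<bullet> (e + t *\<^sub>R D))"
      using form[of "e + t *\<^sub>R D"] by (simp add: power2_norm_eq_inner)
    also have "\<dots> = (e \<bullet> (B *v e) - l * (e \<bullet> e)) + 2 * t * (D \<bullet> (B *v e) - l * (D \<bullet> e)) + t\<^sup>2 * Q"
      unfolding Q_def using selfadj
      by (simp add: matrix_vector_right_distrib matrix_vector_mult_scaleR inner_add_left
          inner_add_right inner_commute algebra_simps power2_eq_square)
    also have "e \<bullet> (B *v e) - l * (e \<bullet> e) = 0"
      using e by (simp add: l_def flip: power2_norm_eq_inner)
    also have "D \<bullet> (B *v e) - l * (D \<bullet> e) = D \<bullet> D"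
      by (simp add: D_def inner_diff_right)
    finally show ?thesis by simp
  qed
  have "D \<bullet> D = 0"
  proof (rule ccontr)
    assume "D \<bullet> D \<noteq> 0"
    then have pos: "D \<bullet> D > 0" by (metis inner_gt_zero_iff inner_zero_left)
    \<comment> \<open>a step so short that the first-order term dominates the quadratic one\<close>
    define t where "t = - (D \<bullet> D) / (\<bar>Q\<bar> + 1)"
    have tneg: "t < 0" unfolding t_def using pos by (simp add: divide_neg_pos)
    have "\<bar>t\<bar> * (\<bar>Q\<bar> + 1) = D \<bullet> D" unfolding t_def using pos by (simp add: abs_mult)
    then have "\<bar>t\<bar> * \<bar>Q\<bar> \<le> D \<bullet> D" by (simp add: algebra_simps)
    then have "- (t * Q) \<le> D \<bullet> D" using abs_mult[of t Q] by linarith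
    then have "2 * (D \<bullet> D) + t * Q > 0" using pos by linarith
    then have "t * (2 * (D \<bullet> D) + t * Q) < 0" using tneg by (simp add: mult_neg_pos)
    then show False using pert[of t] by (simp add: algebra_simps power2_eq_square)
  qed
  then have "l \<in> eigenvalues B"
    unfolding eigenvalues_def D_def using e by (intro CollectI exI[of _ e]) auto
  then have "lambda_min B \<le> l"
    unfolding lambda_min_def using finite_eigenvalues_symmetric[OF sym] by simp
  then show ?thesis
    by (meson form mult_right_mono order_trans zero_le_power2)
qed

section \<open>Coordinate restrictions and coercivity of column submatrices\<close>

text \<open>Coordinate projections keep the type of the vector, so that index sets that vary along the
  iteration can be compared.\<close>
definition restr :: "'k set \<Rightarrow> real^'k \<Rightarrow> real^'k" where
  "restr T v = (\<chi> i. if i \<in> T then v $ i else 0)"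

lemma restr_component [simp]: "restr T v $ i = (if i \<in> T then v $ i else 0)"
  by (simp add: restr_def)

lemma restr_add: "restr T (v + w) = restr T v + restr T w"
  and restr_diff: "restr T (v - w) = restr T v - restr T w"
  and restr_scaleR: "restr T (a *\<^sub>R v) = a *\<^sub>R restr T v"
  and restr_minus: "restr T (- v) = - restr T v"
  by (auto simp: vec_eq_iff)

lemma norm_le_if_abs_component_le:
  fixes v w :: "real^'k"
  assumes "\<And>i. \<bar>v $ i\<bar> \<le> \<bar>w $ i\<bar>"
  shows "norm v \<le> norm w"
  unfolding norm_vec_def by (rule L2_set_mono) (use assms in auto)

lemma norm_restr_mono: "S \<subseteq> T \<Longrightarrow> norm (restr S v) \<le> norm (restr T v)"
  by (rule norm_le_if_abs_component_le) auto

lemma norm_restr_le: "norm (restr T v) \<le> norm v"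
  by (rule norm_le_if_abs_component_le) auto

lemma norm_restr_le_splice_vec:
  "norm (restr T a) \<le> norm (splice_vec T a b)"
  "norm (restr (- T) b) \<le> norm (splice_vec T a b)"
  by (rule norm_le_if_abs_component_le; simp add: splice_vec_def)+

lemma inner_restr_split: "a \<bullet> b = restr T a \<bullet> b + restr (- T) a \<bullet> restr (- T) b"
  unfolding inner_vec_def by (simp flip: sum.distrib) (intro sum.cong, auto)

lemma transpose_cols_mult: "transpose (cols A T) *v v = restr T (transpose A *v v)"
  by (auto simp: vec_eq_iff matrix_vector_mult_def transpose_def cols_def)

text \<open>The matrix whose smallest eigenvalue enters \<open>\<gamma>\<close> has the quadratic form
  \<open>v \<mapsto> norm (A\<^sub>S\<^sup>T v)\<^sup>2\<close>. Index sets larger than \<open>k\<close> are covered because adding coordinates only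
  increases the norm.\<close>
lemma coercive_transpose_restr:
  fixes A :: "real^'n^'m"
  assumes "\<gamma> > 0"
    and \<gamma>: "\<gamma>\<^sup>2 = Min ((\<lambda>T. lambda_min (cols A T ** transpose (cols A T))) ` {T. card T = k})"
    and T: "k \<le> card T"
  shows "\<gamma> * norm v \<le> norm (restr T (transpose A *v v))"
proof -
  obtain S where S: "S \<subseteq> T" "card S = k"
    using T obtain_subset_with_card_n by metis
  define B where "B = cols A S ** transpose (cols A S)"
  have "\<gamma>\<^sup>2 \<le> lambda_min B"
    unfolding \<gamma> B_def using S by (intro Min_le) auto
  then have "\<gamma>\<^sup>2 * (norm v)\<^sup>2 \<le> lambda_min B * (norm v)\<^sup>2"
    by (simp add: mult_right_mono)
  also have "\<dots> \<le> v \<bullet> (B *v v)"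
    by (rule lambda_min_le_Rayleigh) (simp add: B_def matrix_transpose_mul)
  also have "\<dots> = (norm (restr S (transpose A *v v)))\<^sup>2"
    unfolding B_def power2_norm_eq_inner transpose_cols_mult[symmetric]
    by (metis dot_lmul_matrix matrix_vector_mul_assoc transpose_matrix_vector transpose_transpose)
  finally have "(\<gamma> * norm v)\<^sup>2 \<le> (norm (restr S (transpose A *v v)))\<^sup>2"
    by (simp add: power_mult_distrib)
  then have "\<gamma> * norm v \<le> norm (restr S (transpose A *v v))"
    using power2_le_imp_le by fastforce
  also have "\<dots> \<le> norm (restr T (transpose A *v v))" using S(1) by (rule norm_restr_mono)
  finally show ?thesis .
qed

section \<open>Partial gradients of the augmented Lagrangian\<close>

lemma grad_eqI: "GDERIV f x :> d \<Longrightarrow> grad f x = d"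
  unfolding grad_def
proof (rule the_equality)
  fix e assume "GDERIV f x :> d" "GDERIV f x :> e"
  then have "(\<lambda>h. inner h e) = (\<lambda>h. inner h d)"
    unfolding gderiv_def using has_derivative_unique by blast
  then show "e = d" by (metis vector_eq_ldot)
qed

lemma grad_w_g_fun:
  "grad_w (\<lambda>p. g_fun A \<rho> \<mu> p z v) (w, \<xi>) =
     w + transpose A *v (z + \<rho> *\<^sub>R (A *v w + vec 1 - \<xi>)) + \<mu> *\<^sub>R (w - v)"
proof -
  have d: "((*v) A has_derivative (*v) A) (at x)" for x
    by (simp add: bounded_linear_imp_has_derivative)
  have adj: "y \<bullet> (A *v h) = h \<bullet> (y v* A)" "(A *v h) \<bullet> y = h \<bullet> (y v* A)" for h y
    by (metis dot_lmul_matrix inner_commute)+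
  show ?thesis
    unfolding grad_w_def g_fun.simps power2_norm_eq_inner fst_conv snd_conv
    apply (rule grad_eqI)
    unfolding gderiv_def
    apply (rule derivative_eq_intros d refl)+
    apply (simp add: fun_eq_iff inner_add_right inner_add_left inner_diff_right adj
        matrix_vector_right_distrib matrix_vector_mult_diff_distrib matrix_vector_mult_scaleR
        inner_diff_left algebra_simps inner_commute)
    apply (metis adj)
    done
qed

lemma grad_xi_g_fun:
  "grad_xi (\<lambda>p. g_fun A \<rho> \<mu> p z v) (w, \<xi>) = - (z + \<rho> *\<^sub>R (A *v w + vec 1 - \<xi>))"
  unfolding grad_xi_def g_fun.simps power2_norm_eq_inner fst_conv snd_conv
  apply (rule grad_eqI)
  unfolding gderiv_def
  apply (rule derivative_eq_intros refl)+
  apply (simp add: fun_eq_iff inner_add_right inner_add_left inner_diff_right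
      inner_diff_left algebra_simps inner_commute)
  done

section \<open>Consequences of small residuals\<close>

text \<open>Both \<open>T\<close> and \<open>T'\<close> have size \<open>s\<close>, so at least one of \<open>T \<inter> T'\<close> and \<open>T' - T\<close> has at least half of
  \<open>s\<close> indices. On the intersection both gradients are small and their difference controls
  \<open>A\<^sup>T (z' - z)\<close>. If instead the sets differ much, then on \<open>T' - T\<close> the gradient \<open>g'\<close> is small and
  so is \<open>w\<close>, which lies off \<open>T\<close>; this bounds \<open>z'\<close> itself, and symmetrically \<open>T - T'\<close> bounds \<open>z\<close>.
  The second case is what produces the coefficients \<open>2 c + \<mu> + 2\<close> and \<open>2 c + \<mu>\<close>.\<close>
lemma dual_step_bound:
  fixes A :: "real^'n^'m" and w w' a :: "real^'n" and z z' :: "real^'m" and T T' :: "'n set"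
    and c \<mu> \<gamma> :: real
  defines "g \<equiv> w + transpose A *v z + \<mu> *\<^sub>R a"
    and "g' \<equiv> w' + transpose A *v z' + \<mu> *\<^sub>R (w' - w)"
    and "d \<equiv> norm a" and "d' \<equiv> norm (w' - w)"
  assumes coercive: "\<And>S v. s div 2 \<le> card S \<Longrightarrow> \<gamma> * norm v \<le> norm (restr S (transpose A *v v))"
    and nonneg: "\<gamma> \<ge> 0" "c \<ge> 0" "\<mu> \<ge> 0"
    and card: "card T = s" "card T' = s"
    and g: "norm (restr T g) \<le> c * d" and w: "norm (restr (- T) w) \<le> c * d"
    and g': "norm (restr T' g') \<le> c * d'" and w': "norm (restr (- T') w') \<le> c * d'"
  shows "\<gamma> * norm (z' - z) \<le> (2 * c + \<mu> + 2) * d' + (2 * c + \<mu>) * d"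
proof -
  have dd: "d \<ge> 0" "d' \<ge> 0" "\<mu> * d \<ge> 0" "\<mu> * d' \<ge> 0" "c * d \<ge> 0" "c * d' \<ge> 0"
    using nonneg by (auto simp: d_def d'_def)
  have step: "norm (restr S (w' - w)) \<le> d'" "norm (restr S a) \<le> d" for S
    unfolding d'_def d_def by (rule norm_restr_le)+
  have s_split: "card (T \<inter> T') + card (T' - T) = s" "card (T' - T) = card (T - T')"
  proof -
    show "card (T \<inter> T') + card (T' - T) = s"
      using card_Int_Diff[of T' T] card by (simp add: Int_commute)
    then show "card (T' - T) = card (T - T')"
      using card_Int_Diff[of T T'] card by simp
  qed
  show ?thesis
  proof (cases "s div 2 \<le> card (T \<inter> T')")
    case True
    have "transpose A *v (z' - z) = g' - g - (w' - w) - \<mu> *\<^sub>R (w' - w) + \<mu> *\<^sub>R a"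
      unfolding g_def g'_def by (simp add: matrix_vector_mult_diff_distrib algebra_simps)
    then have "restr (T \<inter> T') (transpose A *v (z' - z)) =
        restr (T \<inter> T') g' - restr (T \<inter> T') g - restr (T \<inter> T') (w' - w)
        - \<mu> *\<^sub>R restr (T \<inter> T') (w' - w) + \<mu> *\<^sub>R restr (T \<inter> T') a"
      by (simp only: restr_add restr_diff restr_scaleR)
    also have "norm \<dots> \<le> norm (restr (T \<inter> T') g') + norm (restr (T \<inter> T') g)
        + norm (restr (T \<inter> T') (w' - w)) + \<mu> * norm (restr (T \<inter> T') (w' - w))
        + \<mu> * norm (restr (T \<inter> T') a)"
      using nonneg
      by (intro order_trans[OF norm_triangle_ineq] order_trans[OF norm_triangle_ineq4] add_mono) auto
    also have "\<dots> \<le> c * d' + c * d + d' + \<mu> * d' + \<mu> * d"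
      by (intro add_mono mult_left_mono step order_trans[OF norm_restr_mono g]
          order_trans[OF norm_restr_mono g']) (use nonneg in auto)
    finally show ?thesis
      using coercive[OF True, of "z' - z"] dd by (simp add: algebra_simps)
  next
    case False
    then have large: "s div 2 \<le> card (T' - T)" "s div 2 \<le> card (T - T')"
      using s_split by linarith+
    have "transpose A *v z' = g' - w - (w' - w) - \<mu> *\<^sub>R (w' - w)"
      unfolding g'_def by (simp add: algebra_simps)
    then have "restr (T' - T) (transpose A *v z') = restr (T' - T) g' - restr (T' - T) w
        - restr (T' - T) (w' - w) - \<mu> *\<^sub>R restr (T' - T) (w' - w)"
      by (simp only: restr_add restr_diff restr_scaleR)
    also have "norm \<dots> \<le> norm (restr (T' - T) g') + norm (restr (T' - T) w)
        + norm (restr (T' - T) (w' - w)) + \<mu> * norm (restr (T' - T) (w' - w))"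
      using nonneg by (intro order_trans[OF norm_triangle_ineq4] add_mono) auto
    also have "\<dots> \<le> c * d' + c * d + d' + \<mu> * d'"
      by (intro add_mono mult_left_mono step order_trans[OF norm_restr_mono w]
          order_trans[OF norm_restr_mono g']) (use nonneg in auto)
    finally have new: "\<gamma> * norm z' \<le> c * d' + c * d + d' + \<mu> * d'"
      using coercive[OF large(1), of z'] by linarith
    have "transpose A *v z = g - w' + (w' - w) - \<mu> *\<^sub>R a"
      unfolding g_def by (simp add: algebra_simps)
    then have "restr (T - T') (transpose A *v z) = restr (T - T') g - restr (T - T') w'
        + restr (T - T') (w' - w) - \<mu> *\<^sub>R restr (T - T') a"
      by (simp only: restr_add restr_diff restr_scaleR)
    also have "norm \<dots> \<le> norm (restr (T - T') g) + norm (restr (T - T') w')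
        + norm (restr (T - T') (w' - w)) + \<mu> * norm (restr (T - T') a)"
      using nonneg
      by (intro order_trans[OF norm_triangle_ineq4] order_trans[OF norm_triangle_ineq] add_mono) auto
    also have "\<dots> \<le> c * d + c * d' + d' + \<mu> * d"
      by (intro add_mono mult_left_mono step order_trans[OF norm_restr_mono g]
          order_trans[OF norm_restr_mono w']) (use nonneg in auto)
    finally have old: "\<gamma> * norm z \<le> c * d + c * d' + d' + \<mu> * d"
      using coercive[OF large(2), of z] by linarith
    have "\<gamma> * norm (z' - z) \<le> \<gamma> * norm z' + \<gamma> * norm z"
      using mult_left_mono[OF norm_triangle_ineq4[of z' z] nonneg(1)] by (simp add: algebra_simps)
    then show ?thesis using new old by (simp add: algebra_simps)
  qed
qed

text \<open>If \<open>w\<close> has a nonzero entry off \<open>T\<close>, then by sparsity it has a zero entry at some \<open>j\<close> in \<open>T\<close>. The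
  gradient step at \<open>j\<close> then has modulus \<open>\<alpha> \<bar>g\<^sub>j\<bar> \<le> \<alpha> \<epsilon>\<close>, which by the choice of \<open>T\<close> dominates
  \<open>\<bar>w\<^sub>i - \<alpha> g\<^sub>i\<bar>\<close> for all \<open>i\<close> off \<open>T\<close>. So \<open>g\<close> is of order \<open>\<epsilon>\<close> off \<open>T\<close>, although the residual
  controls it only on \<open>T\<close>.\<close>
lemma inner_off_top_set_quadratic:
  fixes w g :: "real^'n"
  assumes T: "T \<in> top_sets s (w - \<alpha> *\<^sub>R g)" and sparse: "l0norm w \<le> s" and "\<alpha> > 0"
    and g: "norm (restr T g) \<le> \<epsilon>" and w: "norm (restr (- T) w) \<le> \<epsilon>"
  shows "\<bar>restr (- T) g \<bullet> restr (- T) w\<bar> \<le> real CARD('n) * ((1 + \<alpha>) / \<alpha> * \<epsilon>\<^sup>2)"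
proof (cases "restr (- T) w = 0")
  case True
  then show ?thesis using \<open>\<alpha> > 0\<close> by simp
next
  case False
  then obtain i0 where i0: "i0 \<notin> T" "w $ i0 \<noteq> 0"
    by (auto simp: vec_eq_iff split: if_splits)
  have \<epsilon>: "\<epsilon> \<ge> 0" using g norm_ge_zero order_trans by blast
  have small_g: "\<bar>g $ j\<bar> \<le> \<epsilon>" if "j \<in> T" for j
    using component_le_norm_cart[of "restr T g" j] g that by simp
  have small_w: "\<bar>w $ i\<bar> \<le> \<epsilon>" if "i \<notin> T" for i
    using component_le_norm_cart[of "restr (- T) w" i] w that by simp
  obtain j where j: "j \<in> T" "w $ j = 0"
  proof (rule ccontr)
    assume "\<not> thesis"
    then have "insert i0 T \<subseteq> {i. w $ i \<noteq> 0}" using that i0 by auto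
    then have "card (insert i0 T) \<le> l0norm w" unfolding l0norm_def by (rule card_mono[rotated]) simp
    then show False using i0 T sparse by (simp add: top_sets_def)
  qed
  have off: "\<bar>g $ i\<bar> \<le> (1 + \<alpha>) / \<alpha> * \<epsilon>" if i: "i \<notin> T" for i
  proof -
    have "\<bar>w $ i - \<alpha> * g $ i\<bar> \<le> \<bar>\<alpha> * g $ j\<bar>"
      using T i j by (force simp: top_sets_def)
    also have "\<dots> \<le> \<alpha> * \<epsilon>" using small_g[OF j(1)] \<open>\<alpha> > 0\<close> by (simp add: abs_mult)
    finally have "\<bar>\<alpha> * g $ i\<bar> \<le> (1 + \<alpha>) * \<epsilon>"
      using small_w[OF i] by (simp add: algebra_simps abs_if split: if_splits)
    then show ?thesis using \<open>\<alpha> > 0\<close> by (simp add: abs_mult field_simps)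
  qed
  have "\<bar>restr (- T) g \<bullet> restr (- T) w\<bar> \<le> (\<Sum>i\<in>UNIV. \<bar>restr (- T) g $ i * restr (- T) w $ i\<bar>)"
    unfolding inner_vec_def inner_real_def by (rule sum_abs)
  also have "\<dots> \<le> (\<Sum>i\<in>(UNIV::'n set). (1 + \<alpha>) / \<alpha> * \<epsilon>\<^sup>2)"
  proof (rule sum_mono)
    fix i
    show "\<bar>restr (- T) g $ i * restr (- T) w $ i\<bar> \<le> (1 + \<alpha>) / \<alpha> * \<epsilon>\<^sup>2"
    proof (cases "i \<in> T")
      case False
      then have "\<bar>g $ i\<bar> * \<bar>w $ i\<bar> \<le> ((1 + \<alpha>) / \<alpha> * \<epsilon>) * \<epsilon>"
        using off small_w \<epsilon> \<open>\<alpha> > 0\<close> by (intro mult_mono) auto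
      then show ?thesis using False by (simp add: abs_mult power2_eq_square)
    qed (use \<open>\<alpha> > 0\<close> in simp)
  qed
  finally show ?thesis by simp
qed

lemma inner_minus_half_square_le:
  fixes a b :: "'a::real_inner"
  shows "a \<bullet> b - 1 / 2 * (norm b)\<^sup>2 \<le> 1 / 2 * (norm a)\<^sup>2"
  using inner_ge_zero[of "a - b"]
  by (simp add: power2_norm_eq_inner inner_diff_left inner_diff_right inner_commute)

section \<open>Identification of supports and of the zero-one loss near a limit\<close>

text \<open>A coordinate in the support of the limit stays away from zero along the sequence, so it cannot
  belong to a set on which the sequence is below a vanishing tolerance. The bound is uniform in
  \<open>T\<close>, since the index set of a residual may change at every iteration.\<close>
lemma eventually_limit_support_kept:
  fixes X :: "nat \<Rightarrow> real^'k"
  assumes X: "X \<longlonglongrightarrow> x" and \<epsilon>: "\<epsilon> \<longlonglongrightarrow> 0"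
  shows "\<forall>\<^sub>F k in sequentially. \<forall>T. norm (restr (- T) (X k)) \<le> \<epsilon> k \<longrightarrow> restr (- T) x = 0"
proof -
  have "\<forall>\<^sub>F k in sequentially. x $ i \<noteq> 0 \<longrightarrow> \<epsilon> k < \<bar>X k $ i\<bar>" for i
  proof (cases "x $ i = 0")
    case False
    have "(\<lambda>k. \<bar>X k $ i\<bar> - \<epsilon> k) \<longlonglongrightarrow> \<bar>x $ i\<bar> - 0"
      by (intro tendsto_intros X \<epsilon>)
    then have "\<forall>\<^sub>F k in sequentially. 0 < \<bar>X k $ i\<bar> - \<epsilon> k"
      using False by (intro order_tendstoD(1)) auto
    then show ?thesis by (rule eventually_mono) simp
  qed simp
  then have "\<forall>\<^sub>F k in sequentially. \<forall>i. x $ i \<noteq> 0 \<longrightarrow> \<epsilon> k < \<bar>X k $ i\<bar>"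
    by (rule eventually_all_finite)
  then show ?thesis
  proof (rule eventually_mono, intro allI impI)
    fix k T
    assume kept: "\<forall>i. x $ i \<noteq> 0 \<longrightarrow> \<epsilon> k < \<bar>X k $ i\<bar>" and le: "norm (restr (- T) (X k)) \<le> \<epsilon> k"
    have "x $ i = 0" if "i \<notin> T" for i
      using kept component_le_norm_cart[of "restr (- T) (X k)" i] le that by force
    then show "restr (- T) x = 0" by (simp add: vec_eq_iff)
  qed
qed

lemma J_eq_card: "J \<xi> = real (card {i. \<xi> $ i > 0})"
  unfolding J_def step_fn_def by (simp add: sum.If_cases)

text \<open>Positive entries of the limit are eventually positive, so \<open>J\<close> cannot jump down along the
  sequence; the upper bound rules out a jump up, because the values of \<open>J\<close> are integers.\<close>
lemma eventually_J_eq_limit: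
  fixes X :: "nat \<Rightarrow> real^'m"
  assumes X: "X \<longlonglongrightarrow> x" and "lam > 0"
    and le: "\<And>k. lam * J (X k) \<le> b k" and b: "b \<longlonglongrightarrow> lam * J x"
  shows "\<forall>\<^sub>F k in sequentially. J (X k) = J x"
proof -
  have "\<forall>\<^sub>F k in sequentially. x $ i > 0 \<longrightarrow> X k $ i > 0" for i
  proof (cases "x $ i > 0")
    case True
    then show ?thesis
      using order_tendstoD(1)[OF tendsto_vec_nth[OF X], of 0 i] by simp
  qed simp
  then have pos: "\<forall>\<^sub>F k in sequentially. \<forall>i. x $ i > 0 \<longrightarrow> X k $ i > 0"
    by (rule eventually_all_finite)
  have "lam * J x < lam * (J x + 1)" using \<open>lam > 0\<close> by simp
  then have small: "\<forall>\<^sub>F k in sequentially. b k < lam * (J x + 1)"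
    using order_tendstoD(2)[OF b] by blast
  show ?thesis
    using pos small
  proof eventually_elim
    case (elim k)
    have "card {i. x $ i > 0} \<le> card {i. X k $ i > 0}"
      using elim(1) by (intro card_mono) auto
    moreover have "J (X k) < J x + 1"
      using le[of k] elim(2) \<open>lam > 0\<close> by (meson le_less_trans mult_less_cancel_left_pos)
    then have "real (card {i. X k $ i > 0}) < real (card {i. x $ i > 0} + 1)"
      by (simp add: J_eq_card)
    then have "card {i. X k $ i > 0} < card {i. x $ i > 0} + 1" by (simp only: of_nat_less_iff)
    ultimately show "J (X k) = J x" unfolding J_eq_card by simp
  qed
qed

lemma moreau_J_le:
  fixes \<xi> q :: "real^'m"
  assumes "lam \<ge> 0" "\<beta> > 0"
  shows "moreau \<beta> (\<lambda>q. lam * J q) \<xi> \<le> lam * J q + 1 / (2 * \<beta>) * (norm (q - \<xi>))\<^sup>2"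
proof -
  have "bdd_below (range (\<lambda>q::real^'m. lam * J q + 1 / (2 * \<beta>) * (norm (q - \<xi>))\<^sup>2))"
    using assms by (intro bdd_belowI2[where m = 0]) (auto simp: J_eq_card)
  then show ?thesis unfolding moreau_def by (rule cINF_lower) simp
qed

section \<open>Geometric decay of real sequences and of their tails\<close>

text \<open>The recursion says \<open>e\<^sub>k\<^sub>+\<^sub>2 \<le> q\<^sup>2 e\<^sub>k\<close> with \<open>q\<^sup>2 = K / (1 + K)\<close>; monotonicity starts the induction
  for both parities at once.\<close>
lemma two_step_contraction_geometric:
  fixes e :: "nat \<Rightarrow> real"
  assumes dec: "\<And>k. e (Suc k) \<le> e k" and nonneg: "\<And>k. e k \<ge> 0" and "K > 0"
    and rec: "\<And>k. k \<ge> N \<Longrightarrow> e (Suc (Suc k)) \<le> K * (e k - e (Suc (Suc k)))"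
  obtains q c where "0 < q" "q < 1" "c > 0" "\<And>k. k \<ge> N \<Longrightarrow> e k \<le> c * q ^ k"
proof -
  define q where "q = sqrt (K / (1 + K))"
  \<comment> \<open>the summand 1 keeps the constant positive when the sequence is already zero\<close>
  define c where "c = e N / q ^ Suc N + 1"
  have q: "0 < q" "q < 1" "q\<^sup>2 = K / (1 + K)" using \<open>K > 0\<close> by (auto simp: q_def)
  have c: "c > 0" unfolding c_def using q nonneg[of N] by (simp add: add_nonneg_pos)
  have base: "e N \<le> c * q ^ Suc N"
    using q by (simp add: c_def distrib_right)
  have contr: "e (Suc (Suc k)) \<le> q\<^sup>2 * e k" if "k \<ge> N" for k
    using rec[OF that] \<open>K > 0\<close> by (simp add: q(3) field_simps)
  have "e k \<le> c * q ^ k \<and> e (Suc k) \<le> c * q ^ Suc k" if "k \<ge> N" for k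
    using that
  proof (induction k rule: dec_induct)
    case base
    have "c * q ^ Suc N \<le> c * q ^ N" using q c by (simp add: mult_left_le_one_le)
    then show ?case using base \<open>e N \<le> c * q ^ Suc N\<close> dec[of N] by linarith
  next
    case (step k)
    have "e (Suc (Suc k)) \<le> q\<^sup>2 * (c * q ^ k)"
      using contr[OF step.hyps(1)] step.IH q by (smt (verit) mult_left_mono zero_le_power2)
    then show ?case using step.IH by (simp add: power2_eq_square algebra_simps)
  qed
  then show thesis using that q c by blast
qed

lemma geometric_steps_imp_geometric_tail:
  fixes X :: "nat \<Rightarrow> 'a::real_normed_vector"
  assumes X: "X \<longlonglongrightarrow> x" and p: "0 < p" "p < 1"
    and step: "\<And>k. k \<ge> N \<Longrightarrow> norm (X (Suc k) - X k) \<le> C * p ^ k" and k: "k \<ge> N"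
  shows "norm (X k - x) \<le> C / (1 - p) * p ^ k"
proof -
  have C: "C \<ge> 0"
    using step[of N] p norm_ge_zero order_trans
    by (metis le_refl zero_le_mult_iff zero_less_power not_le)
  have part: "norm (X (k + j) - X k) \<le> C / (1 - p) * p ^ k * (1 - p ^ j)" for j
  proof (induction j)
    case (Suc j)
    have "norm (X (k + Suc j) - X k) \<le> norm (X (Suc (k + j)) - X (k + j)) + norm (X (k + j) - X k)"
      using norm_triangle_ineq[of "X (Suc (k + j)) - X (k + j)" "X (k + j) - X k"] by simp
    also have "\<dots> \<le> C * p ^ (k + j) + C / (1 - p) * p ^ k * (1 - p ^ j)"
      using step[of "k + j"] k Suc by (intro add_mono) auto
    also have "\<dots> = C / (1 - p) * p ^ k * (1 - p ^ Suc j)"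
      using p by (simp add: field_simps power_add)
    finally show ?case .
  qed simp
  have "norm (X (k + j) - X k) \<le> C / (1 - p) * p ^ k" for j
  proof -
    have "C / (1 - p) * p ^ k * (1 - p ^ j) \<le> C / (1 - p) * p ^ k * 1"
      using C p by (intro mult_left_mono) auto
    then show ?thesis using part[of j] by simp
  qed
  moreover have "(\<lambda>j. norm (X (k + j) - X k)) \<longlonglongrightarrow> norm (x - X k)"
    by (intro tendsto_intros) (use LIMSEQ_ignore_initial_segment[OF X, of k] in \<open>simp add: add.commute\<close>)
  ultimately have "norm (x - X k) \<le> C / (1 - p) * p ^ k"
    by (intro LIMSEQ_le_const2) auto
  then show ?thesis by (simp add: norm_minus_commute)
qed

section \<open>Descent and error bound along a convergent run\<close>

text \<open>A run of the algorithm with its limit. The spectral hypothesis on the column submatrices enters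
  through coercivity only.\<close>
locale iPAL_run =
  fixes A :: "real^'n^'m" and s :: nat
    and lam \<alpha> \<beta> \<gamma> c1 c2 c3 c4 \<mu> \<rho> \<eta> :: real
    and \<theta> :: "nat \<Rightarrow> real"
    and u :: "nat \<Rightarrow> (real^'n) \<times> (real^'m)" and z :: "nat \<Rightarrow> real^'m"
    and ustar :: "(real^'n) \<times> (real^'m)" and zstar :: "real^'m"
  assumes pos: "lam > 0" "\<alpha> > 0" "\<beta> > 0" "c1 > 0" "c2 > 0" "\<mu> > 0" "\<gamma> > 0"
    and coercive: "\<And>T v. s div 2 \<le> card T \<Longrightarrow> \<gamma> * norm v \<le> norm (restr T (transpose A *v v))"
    and c3: "c3 = (2 * c1 + \<mu> + 2) / \<gamma>"
    and c4: "c4 = (2 * c1 + \<mu>) / \<gamma>"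
    and \<rho>: "\<rho> \<ge> 8 * (c3\<^sup>2 + c4\<^sup>2) / \<mu>"
    and \<eta>: "\<eta> = 4 * c4\<^sup>2 / \<rho>"
    and iPAL: "iPAL_sequence A s lam \<rho> \<mu> \<alpha> \<beta> c1 c2 \<theta> u z"
    and limit: "(\<lambda>k. (u k, z k)) \<longlonglongrightarrow> (ustar, zstar)"
begin

definition W :: "nat \<Rightarrow> real^'n" where "W k = fst (u k)"
definition X :: "nat \<Rightarrow> real^'m" where "X k = snd (u k)"
definition Ws :: "real^'n" where "Ws = fst ustar"
definition Xs :: "real^'m" where "Xs = snd ustar"
definition r :: "nat \<Rightarrow> real^'m" where "r k = A *v W k + vec 1 - X k"
definition d :: "nat \<Rightarrow> real" where "d k = norm (W (Suc k) - W k)"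
definition G :: "nat \<Rightarrow> real^'n" where
  "G k = W (Suc k) + transpose A *v z (Suc k) + \<mu> *\<^sub>R (W (Suc k) - W k)"

text \<open>\<open>G k\<close> is the partial gradient in \<open>w\<close> of the inner objective of iteration \<open>k\<close> at the new iterate
  \<open>u (Suc k)\<close>, and \<open>Lagr\<close> is the augmented Lagrangian with the loss \<open>J\<close>, without any proximal term.
  The value \<open>E k\<close> is the merit value of iteration \<open>k + 1\<close>, because that one involves the step
  from \<open>w\<^sup>k\<close>; \<open>Es\<close> is its limit, in which the constraint violation and the last step have vanished.\<close>
definition Lagr :: "nat \<Rightarrow> real" where
  "Lagr k = 1 / 2 * (norm (W k))\<^sup>2 + z k \<bullet> r k + \<rho> / 2 * (norm (r k))\<^sup>2 + lam * J (X k)"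
definition E :: "nat \<Rightarrow> real" where "E k = Lagr (Suc k) + \<eta> / 2 * (d k)\<^sup>2"
definition Es :: real where "Es = 1 / 2 * (norm Ws)\<^sup>2 + lam * J Xs"

lemma c3_pos: "c3 > 0" and c4_pos: "c4 > 0"
  unfolding c3 c4 using pos by (auto intro!: divide_pos_pos add_pos_pos)

lemma \<rho>_pos: "\<rho> > 0"
proof -
  have "8 * (c3\<^sup>2 + c4\<^sup>2) / \<mu> > 0"
    using c3_pos c4_pos pos by (auto intro!: divide_pos_pos add_pos_pos)
  then show ?thesis using \<rho> by linarith
qed

lemma step: "iPAL_step A s lam \<rho> \<mu> \<alpha> \<beta> c1 c2 (\<theta> k) (u k) (z k) (u (Suc k)) (z (Suc k))"
  using iPAL by (simp add: iPAL_sequence_def)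

lemma z_Suc: "z (Suc k) = z k + \<rho> *\<^sub>R r (Suc k)"
  using step[of k] by (simp add: iPAL_step_def Let_def r_def W_def X_def)

lemma grad_w_step: "grad_w (\<lambda>p. g_fun A \<rho> \<mu> p (z k) (fst (u k))) (u (Suc k)) = G k"
  using grad_w_g_fun[of A \<rho> \<mu> "z k" "W k" "W (Suc k)" "X (Suc k)"] z_Suc[of k]
  by (simp add: W_def X_def G_def r_def)

lemma grad_xi_step: "grad_xi (\<lambda>p. g_fun A \<rho> \<mu> p (z k) (fst (u k))) (u (Suc k)) = - z (Suc k)"
  using grad_xi_g_fun[of A \<rho> \<mu> "z k" "W k" "W (Suc k)" "X (Suc k)"] z_Suc[of k]
  by (simp add: W_def X_def r_def)

lemma sparse: "l0norm (W (Suc k)) \<le> s"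
  using step[of k] by (simp add: iPAL_step_def Let_def W_def)

lemma w_residual:
  obtains T where "T \<in> top_sets s (W (Suc k) - \<alpha> *\<^sub>R G k)"
    "norm (restr T (G k)) \<le> c1 * d k" "norm (restr (- T) (W (Suc k))) \<le> c1 * d k"
proof -
  obtain T where "T \<in> top_sets s (W (Suc k) - \<alpha> *\<^sub>R G k)"
    "norm (splice_vec T (G k) (W (Suc k))) \<le> c1 * d k"
    using step[of k] by (auto simp: iPAL_step_def Let_def R1_def grad_w_step W_def d_def)
  then show thesis using that norm_restr_le_splice_vec order_trans by blast
qed

lemma xi_residual:
  obtains S where "norm (restr S (z (Suc k))) \<le> c2 * (d k)\<^sup>2"
    "norm (restr (- S) (X (Suc k))) \<le> c2 * (d k)\<^sup>2"
proof -
  obtain S where S: "norm (splice_vec S (- z (Suc k)) (X (Suc k))) \<le> c2 * (d k)\<^sup>2"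
    using step[of k] by (auto simp: iPAL_step_def Let_def R2_def grad_xi_step W_def X_def d_def)
  then have "norm (restr S (- z (Suc k))) \<le> c2 * (d k)\<^sup>2"
    "norm (restr (- S) (X (Suc k))) \<le> c2 * (d k)\<^sup>2"
    using norm_restr_le_splice_vec order_trans by blast+
  then show thesis using that by (simp add: restr_minus)
qed

lemma prox_residual:
  "\<beta> / 2 * (norm (z (Suc k)))\<^sup>2 + lam * J (X (Suc k))
     - moreau \<beta> (\<lambda>q. lam * J q) (X (Suc k) + \<beta> *\<^sub>R z (Suc k)) \<le> \<theta> k"
proof -
  have "R3 \<beta> lam (\<lambda>p. g_fun A \<rho> \<mu> p (z k) (fst (u k))) (u (Suc k)) \<le> \<theta> k"
    using step[of k] by (simp add: iPAL_step_def Let_def)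
  then show ?thesis unfolding R3_def grad_xi_step X_def by simp
qed

lemma M_fun_real:
  "l0norm (fst p) \<le> s \<Longrightarrow> M_fun A s lam \<rho> \<kappa> p y v = ereal (g_fun A \<rho> \<kappa> p y v + lam * J (snd p))"
  by (simp add: M_fun_def ind_def sparse_set_def)

lemma M_fun_eq_E: "M_fun A s lam \<rho> \<eta> (u (Suc k)) (z (Suc k)) (fst (u k)) = ereal (E k)"
proof -
  have "g_fun A \<rho> \<eta> (u (Suc k)) (z (Suc k)) (fst (u k)) + lam * J (snd (u (Suc k))) = E k"
    unfolding E_def Lagr_def r_def d_def W_def X_def
    by (subst surjective_pairing[of "u (Suc k)"]) (simp only: g_fun.simps)
  then show ?thesis using sparse[of k] by (simp add: M_fun_real W_def)
qed

text \<open>The descent condition of the algorithm is stated with the old multiplier. Since the multiplier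
  moves by \<open>\<rho>\<close> times the new constraint violation, updating it adds exactly its squared change
  divided by \<open>\<rho>\<close>. The first iterate has to be skipped: the starting point may be infeasible for the
  sparsity constraint, where the descent condition is void.\<close>
lemma Lagr_descent:
  "Lagr (Suc (Suc k)) + \<mu> / 2 * (d (Suc k))\<^sup>2
     \<le> Lagr (Suc k) + (norm (z (Suc (Suc k)) - z (Suc k)))\<^sup>2 / \<rho>"
proof -
  have zd: "z (Suc (Suc k)) - z (Suc k) = \<rho> *\<^sub>R r (Suc (Suc k))"
    using z_Suc[of "Suc k"] by simp
  have "M_fun A s lam \<rho> \<mu> (u (Suc (Suc k))) (z (Suc k)) (fst (u (Suc k)))
      \<le> M_fun A s lam \<rho> \<mu> (u (Suc k)) (z (Suc k)) (fst (u (Suc k)))"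
    using step[of "Suc k"] by (simp add: iPAL_step_def Let_def)
  then have "g_fun A \<rho> \<mu> (u (Suc (Suc k))) (z (Suc k)) (W (Suc k)) + lam * J (X (Suc (Suc k)))
      \<le> g_fun A \<rho> \<mu> (u (Suc k)) (z (Suc k)) (W (Suc k)) + lam * J (X (Suc k))"
    using sparse[of k] sparse[of "Suc k"] by (simp add: M_fun_real W_def X_def)
  moreover have "g_fun A \<rho> \<mu> (u j) (z (Suc k)) (W (Suc k)) = 1 / 2 * (norm (W j))\<^sup>2 + z (Suc k) \<bullet> r j
      + \<rho> / 2 * (norm (r j))\<^sup>2 + \<mu> / 2 * (norm (W j - W (Suc k)))\<^sup>2" for j
    unfolding r_def W_def X_def
    by (subst surjective_pairing[of "u j"]) (simp only: g_fun.simps)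
  moreover have "z (Suc (Suc k)) \<bullet> r (Suc (Suc k)) = z (Suc k) \<bullet> r (Suc (Suc k))
      + (norm (z (Suc (Suc k)) - z (Suc k)))\<^sup>2 / \<rho>"
  proof -
    have "(norm (z (Suc (Suc k)) - z (Suc k)))\<^sup>2 / \<rho> = \<rho> * (r (Suc (Suc k)) \<bullet> r (Suc (Suc k)))"
      unfolding zd power2_norm_eq_inner using \<rho>_pos by simp
    then show ?thesis using z_Suc[of "Suc k"] by (simp add: inner_add_left)
  qed
  ultimately show ?thesis unfolding Lagr_def d_def by simp
qed

lemma z_step: "norm (z (Suc (Suc k)) - z (Suc k)) \<le> c3 * d (Suc k) + c4 * d k"
proof -
  obtain T where T: "T \<in> top_sets s (W (Suc k) - \<alpha> *\<^sub>R G k)"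
    "norm (restr T (G k)) \<le> c1 * d k" "norm (restr (- T) (W (Suc k))) \<le> c1 * d k"
    by (rule w_residual)
  obtain T' where T': "T' \<in> top_sets s (W (Suc (Suc k)) - \<alpha> *\<^sub>R G (Suc k))"
    "norm (restr T' (G (Suc k))) \<le> c1 * d (Suc k)"
    "norm (restr (- T') (W (Suc (Suc k)))) \<le> c1 * d (Suc k)"
    by (rule w_residual)
  have "\<gamma> * norm (z (Suc (Suc k)) - z (Suc k))
      \<le> (2 * c1 + \<mu> + 2) * d (Suc k) + (2 * c1 + \<mu>) * d k"
    unfolding d_def
    by (rule dual_step_bound[where A = A and s = s and T = T and T' = T'])
      (use coercive T T' pos in \<open>auto simp: top_sets_def G_def d_def\<close>)
  then have "norm (z (Suc (Suc k)) - z (Suc k))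
      \<le> ((2 * c1 + \<mu> + 2) * d (Suc k) + (2 * c1 + \<mu>) * d k) / \<gamma>"
    using pos by (simp add: pos_le_divide_eq mult.commute)
  then show ?thesis unfolding c3 c4 by (subst (asm) add_divide_distrib) simp
qed

lemma z_step_sq: "(norm (z (Suc (Suc k)) - z (Suc k)))\<^sup>2 \<le> 2 * c3\<^sup>2 * (d (Suc k))\<^sup>2 + 2 * c4\<^sup>2 * (d k)\<^sup>2"
proof -
  have "(norm (z (Suc (Suc k)) - z (Suc k)))\<^sup>2 \<le> (c3 * d (Suc k) + c4 * d k)\<^sup>2"
    by (rule power_mono[OF z_step]) simp
  also have "\<dots> \<le> 2 * (c3 * d (Suc k))\<^sup>2 + 2 * (c4 * d k)\<^sup>2"
    using sum_squares_bound[of "c3 * d (Suc k)" "c4 * d k"] by (simp add: power2_sum)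
  finally show ?thesis by (simp add: power_mult_distrib algebra_simps)
qed

text \<open>Of the decrease \<open>\<mu>/2\<close> per squared step, the bound on \<open>\<rho>\<close> reserves half for the dual ascent. The
  part of the dual step caused by the previous primal step is paid from the lagged term, whose
  weight \<open>\<eta>\<close> is chosen to cancel it.\<close>
lemma E_descent: "E (Suc k) + \<mu> / 4 * (d (Suc k))\<^sup>2 \<le> E k"
proof -
  have "8 * (c3\<^sup>2 + c4\<^sup>2) \<le> \<rho> * \<mu>"
    using \<rho> pos by (simp add: field_simps)
  then have "(2 * c3\<^sup>2 + 2 * c4\<^sup>2) / \<rho> \<le> \<mu> / 4"
    using \<rho>_pos by (simp add: field_simps)
  then have "(2 * c3\<^sup>2 + 2 * c4\<^sup>2) / \<rho> * (d (Suc k))\<^sup>2 \<le> \<mu> / 4 * (d (Suc k))\<^sup>2"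
    by (rule mult_right_mono) simp
  moreover have "(norm (z (Suc (Suc k)) - z (Suc k)))\<^sup>2 / \<rho>
      \<le> (2 * c3\<^sup>2 * (d (Suc k))\<^sup>2 + 2 * c4\<^sup>2 * (d k)\<^sup>2) / \<rho>"
    using z_step_sq \<rho>_pos by (simp add: divide_right_mono)
  moreover have "(2 * c3\<^sup>2 * (d (Suc k))\<^sup>2 + 2 * c4\<^sup>2 * (d k)\<^sup>2) / \<rho> + \<eta> / 2 * (d (Suc k))\<^sup>2
     = (2 * c3\<^sup>2 + 2 * c4\<^sup>2) / \<rho> * (d (Suc k))\<^sup>2 + \<eta> / 2 * (d k)\<^sup>2"
    unfolding \<eta> by (simp add: add_divide_distrib algebra_simps)
  ultimately show ?thesis using Lagr_descent[of k] unfolding E_def by linarith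
qed

lemma W_lim: "W \<longlonglongrightarrow> Ws" and X_lim: "X \<longlonglongrightarrow> Xs" and z_lim: "z \<longlonglongrightarrow> zstar"
proof -
  have "u \<longlonglongrightarrow> ustar" using tendsto_fst[OF limit] by simp
  then show "W \<longlonglongrightarrow> Ws" "X \<longlonglongrightarrow> Xs"
    unfolding W_def X_def Ws_def Xs_def by (auto intro: tendsto_fst tendsto_snd)
  show "z \<longlonglongrightarrow> zstar" using tendsto_snd[OF limit] by simp
qed

lemma d_lim: "d \<longlonglongrightarrow> 0"
proof -
  have "(\<lambda>k. norm (W (Suc k) - W k)) \<longlonglongrightarrow> norm (Ws - Ws)"
    by (intro tendsto_intros W_lim LIMSEQ_Suc)
  then show ?thesis by (simp add: d_def[abs_def])
qed

lemma AW_lim: "(\<lambda>k. A *v W k) \<longlonglongrightarrow> A *v Ws"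
  by (rule bounded_linear.tendsto[OF matrix_vector_mul_bounded_linear W_lim])

lemma r_lim: "r \<longlonglongrightarrow> 0" and feasible: "Xs = A *v Ws + vec 1"
proof -
  have "(\<lambda>k. (1 / \<rho>) *\<^sub>R (z (Suc k) - z k)) \<longlonglongrightarrow> (1 / \<rho>) *\<^sub>R (zstar - zstar)"
    by (intro tendsto_intros z_lim LIMSEQ_Suc)
  then have "(\<lambda>k. r (Suc k)) \<longlonglongrightarrow> 0"
    using z_Suc \<rho>_pos by simp
  then show r0: "r \<longlonglongrightarrow> 0" by (rule LIMSEQ_imp_Suc)
  have "r \<longlonglongrightarrow> A *v Ws + vec 1 - Xs"
    unfolding r_def by (intro tendsto_intros AW_lim X_lim)
  then have "A *v Ws + vec 1 - Xs = 0" using LIMSEQ_unique r0 by blast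
  then show "Xs = A *v Ws + vec 1" by simp
qed

text \<open>Taking the limit point as competitor in the Moreau envelope turns the third residual into an
  upper bound for \<open>\<lambda> J(\<xi>\<^sup>k)\<close> that tends to \<open>\<lambda> J(\<xi>\<^sup>*)\<close>.\<close>
lemma J_eventually: "\<forall>\<^sub>F k in sequentially. J (X (Suc k)) = J Xs"
proof (rule eventually_J_eq_limit[where lam = lam])
  let ?b = "\<lambda>k. \<theta> k + (lam * J Xs + 1 / (2 * \<beta>) * (norm (Xs - (X (Suc k) + \<beta> *\<^sub>R z (Suc k))))\<^sup>2)
     - \<beta> / 2 * (norm (z (Suc k)))\<^sup>2"
  show "(\<lambda>k. X (Suc k)) \<longlonglongrightarrow> Xs" by (intro LIMSEQ_Suc X_lim)
  show "lam * J (X (Suc k)) \<le> ?b k" for k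
    using prox_residual[of k] pos
      moreau_J_le[of lam \<beta> "X (Suc k) + \<beta> *\<^sub>R z (Suc k)" Xs] by linarith
  have "\<theta> \<longlonglongrightarrow> 0" using iPAL by (simp add: iPAL_sequence_def)
  then have "?b \<longlonglongrightarrow> 0 + (lam * J Xs + 1 / (2 * \<beta>) * (norm (Xs - (Xs + \<beta> *\<^sub>R zstar)))\<^sup>2)
     - \<beta> / 2 * (norm zstar)\<^sup>2"
    by (intro tendsto_intros LIMSEQ_Suc X_lim z_lim)
  also have "0 + (lam * J Xs + 1 / (2 * \<beta>) * (norm (Xs - (Xs + \<beta> *\<^sub>R zstar)))\<^sup>2)
     - \<beta> / 2 * (norm zstar)\<^sup>2 = lam * J Xs"
    using pos by (simp add: power_mult_distrib power2_eq_square)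
  finally show "?b \<longlonglongrightarrow> lam * J Xs" .
qed (use pos in simp)

lemma E_lim: "E \<longlonglongrightarrow> Es"
proof -
  have J: "(\<lambda>k. J (X (Suc k))) \<longlonglongrightarrow> J Xs"
    by (rule tendsto_eventually[OF J_eventually])
  have "E \<longlonglongrightarrow> 1 / 2 * (norm Ws)\<^sup>2 + zstar \<bullet> 0 + \<rho> / 2 * (norm (0::real^'m))\<^sup>2 + lam * J Xs + \<eta> / 2 * 0\<^sup>2"
    unfolding E_def[abs_def] Lagr_def
    by (intro tendsto_intros J d_lim LIMSEQ_Suc[OF W_lim] LIMSEQ_Suc[OF z_lim] LIMSEQ_Suc[OF r_lim])
  then show ?thesis by (simp add: Es_def)
qed

lemma E_antimono: "E (Suc k) \<le> E k"
proof -
  have "0 \<le> \<mu> / 4 * (d (Suc k))\<^sup>2" using pos by simp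
  then show ?thesis using E_descent[of k] by linarith
qed

lemma E_ge_Es: "Es \<le> E k"
  by (rule decseq_ge[OF _ E_lim]) (simp add: decseq_Suc_iff E_antimono)

text \<open>Feasibility of the limit lets the constraint violation be written as
  \<open>A (w - w\<^sup>*) - (\<xi> - \<xi>\<^sup>*)\<close>; the adjoint then moves onto \<open>z\<close>. The strong convexity of the quadratic
  term contributes the negative square.\<close>
lemma Lagr_gap_identity:
  assumes "J (X (Suc k)) = J Xs"
  shows "Lagr (Suc k) - Es =
    (G k - \<mu> *\<^sub>R (W (Suc k) - W k)) \<bullet> (W (Suc k) - Ws) - 1 / 2 * (norm (W (Suc k) - Ws))\<^sup>2
    - z (Suc k) \<bullet> (X (Suc k) - Xs) + \<rho> / 2 * (norm (r (Suc k)))\<^sup>2"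
proof -
  have "z (Suc k) \<bullet> r (Suc k) =
      (transpose A *v z (Suc k)) \<bullet> (W (Suc k) - Ws) - z (Suc k) \<bullet> (X (Suc k) - Xs)"
  proof -
    have "r (Suc k) = A *v (W (Suc k) - Ws) - (X (Suc k) - Xs)"
      unfolding r_def feasible by (simp add: matrix_vector_mult_diff_distrib)
    then show ?thesis
      by (metis dot_lmul_matrix inner_diff_right transpose_matrix_vector)
  qed
  then show ?thesis
    unfolding Lagr_def Es_def G_def assms power2_norm_eq_inner
    by (simp add: inner_add_left inner_add_right inner_diff_left inner_diff_right inner_commute
        field_simps)
qed

text \<open>All terms of the gap identity except the constraint violation are of second order in the last
  step. The bound on \<open>\<langle>z, \<xi> - \<xi>\<^sup>*\<rangle>\<close> pairs a factor of order \<open>d\<^sup>2\<close> with a merely bounded one, which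
  is why the second residual has a squared tolerance.\<close>
lemma Lagr_gap_le:
  obtains C where "C > 0"
    "\<forall>\<^sub>F k in sequentially. Lagr (Suc k) - Es \<le> C * (d k)\<^sup>2 + \<rho> / 2 * (norm (r (Suc k)))\<^sup>2"
proof -
  have "Bseq z" by (rule convergent_imp_Bseq[OF convergentI[OF z_lim]])
  moreover have "Bseq (\<lambda>k. X k - Xs)"
    by (rule convergent_imp_Bseq[OF convergentI[OF tendsto_diff[OF X_lim tendsto_const]]])
  ultimately obtain Bz Bx where Bz: "Bz > 0" "\<And>k. norm (z k) \<le> Bz"
    and Bx: "Bx > 0" "\<And>k. norm (X k - Xs) \<le> Bx"
    unfolding Bseq_def by blast
  define C0 where "C0 = real CARD('n) * ((1 + \<alpha>) / \<alpha> * c1\<^sup>2)"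
  define C where "C = 1 / 2 * (c1 + \<mu>)\<^sup>2 + C0 + c2 * (Bx + Bz)"
  have "C > 0"
    unfolding C_def C0_def using pos Bz Bx by (intro add_nonneg_pos add_nonneg_nonneg) auto
  have "(\<lambda>k. c1 * d k) \<longlonglongrightarrow> c1 * 0" "(\<lambda>k. c2 * (d k)\<^sup>2) \<longlonglongrightarrow> c2 * 0\<^sup>2"
    by (intro tendsto_intros d_lim)+
  then have eps: "(\<lambda>k. c1 * d k) \<longlonglongrightarrow> 0" "(\<lambda>k. c2 * (d k)\<^sup>2) \<longlonglongrightarrow> 0" by simp_all
  have "\<forall>\<^sub>F k in sequentially. Lagr (Suc k) - Es \<le> C * (d k)\<^sup>2 + \<rho> / 2 * (norm (r (Suc k)))\<^sup>2"
    using J_eventually eventually_limit_support_kept[OF LIMSEQ_Suc[OF W_lim] eps(1)]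
      eventually_limit_support_kept[OF LIMSEQ_Suc[OF X_lim] eps(2)]
  proof eventually_elim
    case (elim k)
    let ?e = "W (Suc k) - Ws"
    obtain T where T: "T \<in> top_sets s (W (Suc k) - \<alpha> *\<^sub>R G k)"
      "norm (restr T (G k)) \<le> c1 * d k" "norm (restr (- T) (W (Suc k))) \<le> c1 * d k"
      by (rule w_residual)
    obtain S where S: "norm (restr S (z (Suc k))) \<le> c2 * (d k)\<^sup>2"
      "norm (restr (- S) (X (Suc k))) \<le> c2 * (d k)\<^sup>2"
      by (rule xi_residual)
    have Ws0: "restr (- T) Ws = 0" and Xs0: "restr (- S) Xs = 0"
      using elim T(3) S(2) by blast+
    \<comment> \<open>the part of the gradient that is controlled by the step length\<close>
    define h where "h = restr T (G k) - \<mu> *\<^sub>R (W (Suc k) - W k)"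
    have h: "norm h \<le> (c1 + \<mu>) * d k"
    proof -
      have "norm h \<le> norm (restr T (G k)) + norm (\<mu> *\<^sub>R (W (Suc k) - W k))"
        unfolding h_def by (rule norm_triangle_ineq4)
      moreover have "norm (\<mu> *\<^sub>R (W (Suc k) - W k)) = \<mu> * d k"
        unfolding norm_scaleR d_def using pos by simp
      ultimately show ?thesis using T(2) by (simp add: distrib_right)
    qed
    have w_part: "(G k - \<mu> *\<^sub>R (W (Suc k) - W k)) \<bullet> ?e - 1 / 2 * (norm ?e)\<^sup>2
        \<le> (1 / 2 * (c1 + \<mu>)\<^sup>2 + C0) * (d k)\<^sup>2"
    proof -
      have "(G k - \<mu> *\<^sub>R (W (Suc k) - W k)) \<bullet> ?e
          = h \<bullet> ?e + restr (- T) (G k) \<bullet> restr (- T) (W (Suc k))"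
        using inner_restr_split[of "G k" ?e T] Ws0 unfolding h_def
        by (simp add: inner_diff_left restr_diff)
      moreover have "h \<bullet> ?e - 1 / 2 * (norm ?e)\<^sup>2 \<le> 1 / 2 * (norm h)\<^sup>2"
        by (rule inner_minus_half_square_le)
      moreover have "(norm h)\<^sup>2 \<le> (c1 + \<mu>)\<^sup>2 * (d k)\<^sup>2"
        using power_mono[OF h, of 2] by (simp add: power_mult_distrib)
      moreover have "restr (- T) (G k) \<bullet> restr (- T) (W (Suc k)) \<le> C0 * (d k)\<^sup>2"
        using inner_off_top_set_quadratic[OF T(1) sparse pos(2) T(2,3)]
        by (simp add: C0_def power_mult_distrib algebra_simps)
      ultimately show ?thesis by (simp add: algebra_simps)
    qed
    have "- (z (Suc k) \<bullet> (X (Suc k) - Xs))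
        \<le> norm (restr S (z (Suc k))) * norm (X (Suc k) - Xs)
          + norm (restr (- S) (z (Suc k))) * norm (restr (- S) (X (Suc k)))"
      using inner_restr_split[of "z (Suc k)" "X (Suc k) - Xs" S] Xs0
        Cauchy_Schwarz_ineq2[of "restr S (z (Suc k))" "X (Suc k) - Xs"]
        Cauchy_Schwarz_ineq2[of "restr (- S) (z (Suc k))" "restr (- S) (X (Suc k))"]
      by (simp add: restr_diff)
    also have "\<dots> \<le> (c2 * (d k)\<^sup>2) * Bx + Bz * (c2 * (d k)\<^sup>2)"
      using S Bx Bz pos order_trans[OF norm_restr_le Bz(2)] by (intro add_mono mult_mono) auto
    finally have "- (z (Suc k) \<bullet> (X (Suc k) - Xs)) \<le> c2 * (Bx + Bz) * (d k)\<^sup>2"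
      by (simp add: algebra_simps)
    then show ?case
      using w_part Lagr_gap_identity[OF elim(1)] unfolding C_def by (simp add: algebra_simps)
  qed
  with \<open>C > 0\<close> show thesis by (rule that)
qed

text \<open>The constraint violation is the dual step divided by \<open>\<rho>\<close>, so it is controlled by the last two
  primal steps; this is why two squared steps appear.\<close>
lemma E_gap_le:
  obtains C where "C > 0" "\<forall>\<^sub>F k in sequentially. E (Suc k) - Es \<le> C * ((d (Suc k))\<^sup>2 + (d k)\<^sup>2)"
proof -
  obtain C1 where C1: "C1 > 0"
    "\<forall>\<^sub>F k in sequentially. Lagr (Suc k) - Es \<le> C1 * (d k)\<^sup>2 + \<rho> / 2 * (norm (r (Suc k)))\<^sup>2"
    by (rule Lagr_gap_le)
  define C where "C = C1 + \<eta> / 2 + (c3\<^sup>2 + c4\<^sup>2) / \<rho>"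
  have \<eta>0: "\<eta> \<ge> 0" unfolding \<eta> using \<rho>_pos by simp
  have "C > 0" unfolding C_def using C1 \<eta>0 \<rho>_pos by (intro add_pos_nonneg) auto
  have "\<forall>\<^sub>F k in sequentially. Lagr (Suc (Suc k)) - Es
      \<le> C1 * (d (Suc k))\<^sup>2 + \<rho> / 2 * (norm (r (Suc (Suc k))))\<^sup>2"
    using C1(2) eventually_sequentially_Suc
      [of "\<lambda>k. Lagr (Suc k) - Es \<le> C1 * (d k)\<^sup>2 + \<rho> / 2 * (norm (r (Suc k)))\<^sup>2"] by blast
  then have "\<forall>\<^sub>F k in sequentially. E (Suc k) - Es \<le> C * ((d (Suc k))\<^sup>2 + (d k)\<^sup>2)"
  proof (rule eventually_mono)
    fix k
    let ?a = "(d (Suc k))\<^sup>2" and ?b = "(d k)\<^sup>2"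
    assume le: "Lagr (Suc (Suc k)) - Es \<le> C1 * ?a + \<rho> / 2 * (norm (r (Suc (Suc k))))\<^sup>2"
    have "(norm (z (Suc (Suc k)) - z (Suc k)))\<^sup>2 = \<rho> * (\<rho> * (norm (r (Suc (Suc k))))\<^sup>2)"
      using z_Suc[of "Suc k"] by (simp add: power_mult_distrib power2_eq_square)
    then have "\<rho> / 2 * (norm (r (Suc (Suc k))))\<^sup>2 = (norm (z (Suc (Suc k)) - z (Suc k)))\<^sup>2 / (2 * \<rho>)"
      using \<rho>_pos by simp
    also have "\<dots> \<le> (2 * c3\<^sup>2 * ?a + 2 * c4\<^sup>2 * ?b) / (2 * \<rho>)"
      using z_step_sq \<rho>_pos by (intro divide_right_mono) auto
    also have "\<dots> = c3\<^sup>2 / \<rho> * ?a + c4\<^sup>2 / \<rho> * ?b"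
      using \<rho>_pos by (simp add: field_simps)
    finally have "E (Suc k) - Es \<le> (C1 + \<eta> / 2 + c3\<^sup>2 / \<rho>) * ?a + c4\<^sup>2 / \<rho> * ?b"
      using le unfolding E_def by (simp add: algebra_simps)
    also have "\<dots> \<le> C * ?a + C * ?b"
      unfolding C_def using C1 \<eta>0 \<rho>_pos
      by (intro add_mono mult_right_mono) (auto simp: add_divide_distrib)
    finally show "E (Suc k) - Es \<le> C * ((d (Suc k))\<^sup>2 + (d k)\<^sup>2)" by (simp add: distrib_left)
  qed
  with \<open>C > 0\<close> show thesis by (rule that)
qed

text \<open>Descent bounds the two squared steps in the error bound by the merit decrease over the same two
  iterations.\<close>
lemma E_linear_rate:
  obtains q c N where "0 < q" "q < 1" "c > 0" "\<And>k. k \<ge> N \<Longrightarrow> E k - Es \<le> c * q ^ k"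
proof -
  obtain C where C: "C > 0"
    and ev: "\<forall>\<^sub>F k in sequentially. E (Suc k) - Es \<le> C * ((d (Suc k))\<^sup>2 + (d k)\<^sup>2)"
    by (rule E_gap_le)
  obtain N where N: "\<And>k. k \<ge> N \<Longrightarrow> E (Suc k) - Es \<le> C * ((d (Suc k))\<^sup>2 + (d k)\<^sup>2)"
    using ev unfolding eventually_sequentially by blast
  have "E (Suc (Suc k)) - Es \<le> 4 * C / \<mu> * ((E k - Es) - (E (Suc (Suc k)) - Es))" if "k \<ge> N" for k
  proof -
    have "\<mu> / 4 * ((d (Suc (Suc k)))\<^sup>2 + (d (Suc k))\<^sup>2) \<le> E k - E (Suc (Suc k))"
      using E_descent[of k] E_descent[of "Suc k"] by (simp add: algebra_simps)
    then have "(d (Suc (Suc k)))\<^sup>2 + (d (Suc k))\<^sup>2 \<le> 4 / \<mu> * (E k - E (Suc (Suc k)))"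
      using pos by (simp add: field_simps)
    then have "C * ((d (Suc (Suc k)))\<^sup>2 + (d (Suc k))\<^sup>2) \<le> C * (4 / \<mu> * (E k - E (Suc (Suc k))))"
      using C by (intro mult_left_mono) auto
    then show ?thesis using N[of "Suc k"] that by (simp add: algebra_simps)
  qed
  moreover have "4 * C / \<mu> > 0" using C pos by simp
  ultimately obtain q c where "0 < q" "q < 1" "c > 0" "\<And>k. k \<ge> N \<Longrightarrow> E k - Es \<le> c * q ^ k"
    using two_step_contraction_geometric[of "\<lambda>k. E k - Es" "4 * C / \<mu>" N] E_antimono E_ge_Es
    by (metis diff_ge_0_iff_ge diff_right_mono)
  then show thesis by (rule that)
qed

text \<open>A single step cannot cost more than the whole remaining gap, so steps decay like the square root
  of the gap.\<close>
lemma d_linear_rate: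
  assumes "0 < q" "c \<ge> 0" and rate: "E k - Es \<le> c * q ^ k"
  shows "d (Suc k) \<le> sqrt (4 * c / \<mu>) * sqrt q ^ k"
proof -
  have "\<mu> / 4 * (d (Suc k))\<^sup>2 \<le> c * q ^ k"
    using E_descent[of k] E_ge_Es[of "Suc k"] rate by linarith
  then have "(d (Suc k))\<^sup>2 \<le> 4 * c / \<mu> * q ^ k"
    using pos by (simp add: field_simps)
  also have "\<dots> = (sqrt (4 * c / \<mu>) * sqrt q ^ k)\<^sup>2"
  proof -
    have "(sqrt q ^ k)\<^sup>2 = (sqrt q)\<^sup>2 ^ k" by (metis power_even_eq power_mult)
    then show ?thesis using assms pos by (simp add: power_mult_distrib)
  qed
  finally show ?thesis
    by (rule power2_le_imp_le) (use assms pos in auto)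
qed

text \<open>The primal and dual steps decay geometrically with ratio \<open>sqrt q\<close>, hence so do the tails of their
  sums. The variable \<open>\<xi>\<close> is recovered from \<open>w\<close> and the constraint violation, that is, the dual
  step.\<close>
lemma iterates_linear_rate:
  assumes q: "0 < q" "q < 1" and "c > 0" and rate: "\<And>k. k \<ge> N \<Longrightarrow> E k - Es \<le> c * q ^ k"
  shows "\<exists>N'. \<exists>cw>0. \<exists>cx>0. \<exists>cz>0. \<forall>k\<ge>N'.
    norm (W k - Ws) \<le> cw * sqrt q ^ k \<and> norm (X k - Xs) \<le> cx * sqrt q ^ k \<and>
    norm (z k - zstar) \<le> cz * sqrt q ^ k"
proof -
  define p where "p = sqrt q"
  have p: "0 < p" "p < 1" using q by (auto simp: p_def)
  define D where "D = sqrt (4 * c / \<mu>) / p"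
  have "D > 0" unfolding D_def using p pos \<open>c > 0\<close> by simp
  have d_rate: "d k \<le> D * p ^ k" if k: "k \<ge> Suc N" for k
  proof -
    obtain j where j: "k = Suc j" "j \<ge> N" using k by (cases k) auto
    have "d (Suc j) \<le> sqrt (4 * c / \<mu>) * p ^ j"
      unfolding p_def using d_linear_rate rate[OF j(2)] q \<open>c > 0\<close> by simp
    then show ?thesis using p by (simp add: D_def j)
  qed
  define B where "B = c3 * D + c4 * D / p"
  have "B > 0" unfolding B_def using c3_pos c4_pos \<open>D > 0\<close> p by (simp add: add_pos_pos)
  have z_rate: "norm (z (Suc k) - z k) \<le> B * p ^ k" if k: "k \<ge> Suc (Suc N)" for k
  proof -
    obtain j where j: "k = Suc j" "j \<ge> Suc N" using k by (cases k) auto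
    have "norm (z (Suc k) - z k) \<le> c3 * (D * p ^ k) + c4 * (D * p ^ j)"
      using order_trans[OF z_step[of j] add_mono[OF mult_left_mono mult_left_mono]]
        d_rate[of k] d_rate[of j] c3_pos c4_pos j by simp
    also have "\<dots> = B * p ^ k" unfolding B_def j using p by (simp add: field_simps)
    finally show ?thesis .
  qed
  have W_tail: "norm (W k - Ws) \<le> D / (1 - p) * p ^ k" if "k \<ge> Suc N" for k
    by (rule geometric_steps_imp_geometric_tail[OF W_lim p _ that]) (use d_rate in \<open>simp add: d_def\<close>)
  have z_tail: "norm (z k - zstar) \<le> B / (1 - p) * p ^ k" if "k \<ge> Suc (Suc N)" for k
    by (rule geometric_steps_imp_geometric_tail[OF z_lim p _ that]) (rule z_rate)
  obtain a where a: "a > 0" "\<And>v. norm (A *v v) \<le> norm v * a"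
    using bounded_linear.pos_bounded[OF matrix_vector_mul_bounded_linear[of A]] by blast
  define H where "H = D / (1 - p) * a + B / (\<rho> * p)"
  have X_tail: "norm (X k - Xs) \<le> H * p ^ k" if k: "k \<ge> Suc (Suc (Suc N))" for k
  proof -
    obtain j where j: "k = Suc j" "j \<ge> Suc (Suc N)" using k by (cases k) auto
    have "X k - Xs = A *v (W k - Ws) - r k"
      unfolding r_def feasible by (simp add: matrix_vector_mult_diff_distrib)
    then have "norm (X k - Xs) \<le> norm (A *v (W k - Ws)) + norm (r k)"
      by (simp add: norm_triangle_ineq4)
    also have "norm (A *v (W k - Ws)) \<le> D / (1 - p) * p ^ k * a"
      using order_trans[OF a(2) mult_right_mono[OF W_tail]] a(1) k by simp
    also have "norm (r k) \<le> B / (\<rho> * p) * p ^ k"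
    proof -
      have "\<rho> * norm (r k) \<le> B * p ^ j"
        using z_rate[OF j(2)] z_Suc[of j] \<rho>_pos by (simp add: j)
      then show ?thesis using \<rho>_pos p by (simp add: j field_simps)
    qed
    finally show ?thesis by (simp add: H_def algebra_simps)
  qed
  have "D / (1 - p) > 0" "B / (1 - p) > 0" using \<open>D > 0\<close> \<open>B > 0\<close> p by auto
  moreover have "H > 0" unfolding H_def using \<open>D > 0\<close> \<open>B > 0\<close> p a(1) \<rho>_pos
    by (intro add_pos_pos mult_pos_pos divide_pos_pos) auto
  ultimately show ?thesis
    using W_tail X_tail z_tail unfolding p_def[symmetric]
    by (intro exI[of _ "Suc (Suc (Suc N))"] exI[of _ "D / (1 - p)"] exI[of _ H]
        exI[of _ "B / (1 - p)"] conjI allI impI) (auto simp del: times_divide_eq_left)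
qed

end

section \<open>Linear convergence\<close>

theorem theorem7:
  fixes b :: "'n::finite" and x :: "'m::finite \<Rightarrow> 'n \<Rightarrow> real" and y :: "'m \<Rightarrow> real"
    and A :: "real^'n^'m" and s :: nat
    and lam \<alpha> \<beta> \<gamma> c1 c2 c3 c4 \<mu> \<rho> \<eta> :: real
    and \<theta> :: "nat \<Rightarrow> real"
    and u :: "nat \<Rightarrow> (real^'n) \<times> (real^'m)" and z :: "nat \<Rightarrow> real^'m"
    and ustar :: "(real^'n) \<times> (real^'m)" and zstar :: "real^'m"
    and Mseq :: "nat \<Rightarrow> ereal" and Mstar :: ereal
  assumes s: "1 \<le> s" "s \<le> CARD('n)"
    and y: "\<And>i. y i \<in> {1, -1}"
    and A: "A = data_matrix b x y"
    and pos: "lam > 0" "\<alpha> > 0" "\<beta> > 0" "c1 > 0" "c2 > 0" "\<mu> > 0"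
    and rank: "\<And>T. card T = s div 2 \<Longrightarrow> full_row_rank (cols A T)"
    and \<gamma>: "\<gamma> > 0"
      "\<gamma>\<^sup>2 = Min ((\<lambda>T. lambda_min (cols A T ** transpose (cols A T))) ` {T. card T = s div 2})"
    and c3: "c3 = (2 * c1 + \<mu> + 2) / \<gamma>"
    and c4: "c4 = (2 * c1 + \<mu>) / \<gamma>"
    and \<rho>: "\<rho> \<ge> max (2 / \<gamma>\<^sup>2) (8 * (c3\<^sup>2 + c4\<^sup>2) / \<mu>)"
    and \<eta>: "\<eta> = 4 * c4\<^sup>2 / \<rho>"
    and iPAL: "iPAL_sequence A s lam \<rho> \<mu> \<alpha> \<beta> c1 c2 \<theta> u z"
    and limit: "(\<lambda>k. (u k, z k)) \<longlonglongrightarrow> (ustar, zstar)"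
    and Mseq: "\<And>k. Mseq (Suc k) = M_fun A s lam \<rho> \<eta> (u (Suc k)) (z (Suc k)) (fst (u k))"
    and Mstar: "Mstar = lim Mseq"
  shows "\<exists>q::real. 0 < q \<and> q < 1 \<and>
     (\<exists>cm>0. \<exists>kstar. \<forall>k\<ge>kstar. Mseq k - Mstar \<le> ereal (cm * q ^ k)) \<and>
     (\<exists>kstar. \<exists>cw>0. \<exists>c\<xi>>0. \<exists>cz>0. \<forall>k\<ge>kstar.
        norm (fst (u k) - fst ustar) \<le> cw * sqrt q ^ k \<and>
        norm (snd (u k) - snd ustar) \<le> c\<xi> * sqrt q ^ k \<and>
        norm (z k - zstar) \<le> cz * sqrt q ^ k)"
proof -
  interpret iPAL_run A s lam \<alpha> \<beta> \<gamma> c1 c2 c3 c4 \<mu> \<rho> \<eta> \<theta> u z ustar zstar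
    by standard (use pos \<gamma> c3 c4 \<rho> \<eta> iPAL limit coercive_transpose_restr[OF \<gamma>] in auto)
  obtain q c N where q: "0 < q" "q < 1" and "c > 0"
    and rate: "\<And>k. k \<ge> N \<Longrightarrow> E k - Es \<le> c * q ^ k"
    by (rule E_linear_rate) blast
  have Mseq_E: "Mseq (Suc k) = ereal (E k)" for k
    unfolding Mseq by (rule M_fun_eq_E)
  \<comment> \<open>the merit value at index 0 is unconstrained, hence the shifted sequence\<close>
  have "(\<lambda>k. Mseq (Suc k)) \<longlonglongrightarrow> ereal Es"
    unfolding Mseq_E by (intro tendsto_ereal E_lim)
  then have Mstar_Es: "Mstar = ereal Es"
    unfolding Mstar by (rule limI[OF LIMSEQ_imp_Suc])
  have M_rate: "Mseq k - Mstar \<le> ereal (c / q * q ^ k)" if k: "k \<ge> Suc N" for k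
  proof -
    obtain j where j: "k = Suc j" "j \<ge> N" using k by (cases k) auto
    then show ?thesis using rate[OF j(2)] q by (simp add: Mseq_E Mstar_Es)
  qed
  show ?thesis
  proof (rule exI[of _ q], intro conjI)
    show "\<exists>cm>0. \<exists>kstar. \<forall>k\<ge>kstar. Mseq k - Mstar \<le> ereal (cm * q ^ k)"
      using M_rate \<open>c > 0\<close> q by (intro exI[of _ "c / q"]) auto
    show "\<exists>kstar. \<exists>cw>0. \<exists>c\<xi>>0. \<exists>cz>0. \<forall>k\<ge>kstar.
        norm (fst (u k) - fst ustar) \<le> cw * sqrt q ^ k \<and>
        norm (snd (u k) - snd ustar) \<le> c\<xi> * sqrt q ^ k \<and>
        norm (z k - zstar) \<le> cz * sqrt q ^ k"
      using iterates_linear_rate[OF q \<open>c > 0\<close> rate] unfolding W_def X_def Ws_def Xs_def .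
  qed (use q in auto)
qed

end
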